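(* There are (finite-dimensional) normed spaces that embed in $L_0$, but do not embed in $L_p$ for any $p>0$ ($p<\infty$).
   Context: A normed space $(\mathbb{R}^n,\|\cdot\|)$ embeds in $L_0$ if there exist a finite Borel (non-negative) measure $\mu$ on $S^{n-1}$ and a constant $C\in\mathbb{R}$ such that for every $x\in\mathbb{R}^n$, $\ln\|x\|=\int_{S^{n-1}}\ln|(x,\xi)|\,d\mu(\xi)+C$. For $0<p<\infty$, $(\mathbb{R}^n,\|\cdot\|)$ embeds (isometrically) in $L_p$ if and only if there is a finite Borel (non-negative) measure $\mu$ on $S^{n-1}$ such that for every $x\in\mathbb{R}^n$, $\|x\|^p=\int_{S^{n-1}}|(x,\xi)|^p\,d\mu(\xi)$. *)

theory Defs
  imports "HOL-Analysis.Analysis"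
begin

(* R^n is the library's Euclidean_space n: functions nat => real that vanish at all indices >= n. *)

abbreviation Rn :: "nat \<Rightarrow> (nat \<Rightarrow> real) set" where
  "Rn n \<equiv> topspace (Euclidean_space n)"

definition dotp :: "nat \<Rightarrow> (nat \<Rightarrow> real) \<Rightarrow> (nat \<Rightarrow> real) \<Rightarrow> real" where
  "dotp n x y = (\<Sum>i<n. x i * y i)"

definition unit_sphere :: "nat \<Rightarrow> (nat \<Rightarrow> real) set" where
  "unit_sphere n = {x \<in> Rn n. dotp n x x = 1}"

(* N is only constrained on Rn n; its values elsewhere are irrelevant. *)
definition normed_space :: "nat \<Rightarrow> ((nat \<Rightarrow> real) \<Rightarrow> real) \<Rightarrow> bool" where
  "normed_space n N \<longleftrightarrow>
     (\<forall>x\<in>Rn n. 0 \<le> N x) \<and>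
     (\<forall>x\<in>Rn n. N x = 0 \<longleftrightarrow> x = (\<lambda>i. 0)) \<and>
     (\<forall>x\<in>Rn n. \<forall>c. N (\<lambda>i. c * x i) = \<bar>c\<bar> * N x) \<and>
     (\<forall>x\<in>Rn n. \<forall>y\<in>Rn n. N (\<lambda>i. x i + y i) \<le> N x + N y)"

(* The type nat => real carries the product topology, which induces the usual topology on Rn n,
   so restricting borel gives the usual Borel sets of the sphere. *)
definition sphere_measure :: "nat \<Rightarrow> (nat \<Rightarrow> real) measure \<Rightarrow> bool" where
  "sphere_measure n \<mu> \<longleftrightarrow>
     finite_measure \<mu> \<and> sets \<mu> = sets (restrict_space borel (unit_sphere n))"

(* At x = 0 the defining identity reads -\<infinity> = -\<infinity> under the convention ln 0 = -\<infinity>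
   and imposes nothing (\<mu> = 0 being excluded by the other x, as ln (N x) is not constant for n > 0),
   so it is required for x \<noteq> 0 only.
   There the left-hand side is finite, hence so is the integral. Since ln 0 = 0 in HOL, a finite
   integral of the extended-valued ln |(x,\<xi>)| amounts to: (x,\<xi>) \<noteq> 0 almost everywhere,
   and the real-valued integrand is integrable. *)
definition embeds_L0 :: "nat \<Rightarrow> ((nat \<Rightarrow> real) \<Rightarrow> real) \<Rightarrow> bool" where
  "embeds_L0 n N \<longleftrightarrow>
     (\<exists>\<mu> C. sphere_measure n \<mu> \<and>
        (\<forall>x\<in>Rn n. x \<noteq> (\<lambda>i. 0) \<longrightarrow>
           (AE \<xi> in \<mu>. dotp n x \<xi> \<noteq> 0) \<and>
           integrable \<mu> (\<lambda>\<xi>. ln \<bar>dotp n x \<xi>\<bar>) \<and>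
           ln (N x) = (\<integral>\<xi>. ln \<bar>dotp n x \<xi>\<bar> \<partial>\<mu>) + C))"

(* For p > 0 the integrand is bounded and continuous on the sphere, hence integrable;
   0 powr p = 0 is the right value at 0. *)
definition embeds_Lp :: "real \<Rightarrow> nat \<Rightarrow> ((nat \<Rightarrow> real) \<Rightarrow> real) \<Rightarrow> bool" where
  "embeds_Lp p n N \<longleftrightarrow>
     (\<exists>\<mu>. sphere_measure n \<mu> \<and>
        (\<forall>x\<in>Rn n. N x powr p = (\<integral>\<xi>. \<bar>dotp n x \<xi>\<bar> powr p \<partial>\<mu>)))"

end

theory Submission
  imports Defs "HOL-Probability.Probability_Measure"
begin

text \<open>
  The space is \<open>\<real>\<^sup>2 \<oplus> \<real>\<^sup>2\<close> with the maximum of the two Euclidean norms, and the representing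
  measure for \<open>L\<^sub>0\<close> is the uniform measure on the Clifford torus. Everything rests on
  \<open>(cos t + cos b) (cos t - cos b) = - sin (t + b) sin (t - b)\<close>.

  Taking logarithms and averaging over \<open>t\<close>, rotation invariance shows that the mean of
  \<open>ln \<bar>cos t + y\<bar>\<close> does not depend on \<open>y \<in> [-1, 1]\<close>. Hence the mean of
  \<open>ln \<bar>q cos s + r cos t\<bar>\<close> over the torus is \<open>ln (max q r)\<close> up to a constant.

  For \<open>p > 0\<close> the pairs \<open>\<bar>cos t \<plusminus> cos b\<bar>\<close> and \<open>\<bar>sin (t \<plusminus> b)\<bar>\<close> have equal products while the former
  has the larger sum of squares, hence the larger sum of \<open>p\<close>-th powers. So the mean of
  \<open>\<bar>cos t + y\<bar>\<^sup>p\<close> is strictly larger for \<open>y \<noteq> 0\<close> than for \<open>y = 0\<close>. But the norm of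
  \<open>(cos t, sin t, z, 0)\<close> is \<open>1\<close> for both \<open>z = 0\<close> and \<open>z = 1\<close>; comparing the averages over \<open>t\<close>,
  a measure representing the norm in \<open>L\<^sub>p\<close> would vanish off the hyperplane \<open>\<xi>\<^sub>2 = 0\<close>, giving the
  vector \<open>(0, 0, 1, 0)\<close> norm zero.
\<close>

section \<open>The uniform measure on the circle and its rotation invariance\<close>

definition angle :: "real measure" where
  "angle = uniform_measure lborel {0..<2 * pi}"

lemma sets_angle [simp, measurable_cong]: "sets angle = sets borel"
  by (simp add: angle_def)

lemma space_angle [simp]: "space angle = UNIV"
  by (simp add: angle_def)

lemma prob_space_angle: "prob_space angle"
  unfolding angle_def by (rule prob_space_uniform_measure) auto

interpretation angle: prob_space angle
  by (rule prob_space_angle)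

lemma emeasure_lborel_translate:
  fixes S :: "real set"
  assumes "S \<in> sets borel"
  shows "emeasure lborel {t. t + a \<in> S} = emeasure lborel S"
proof -
  have "emeasure (distr lborel borel ((+) a)) S = emeasure lborel ((+) a -` S \<inter> space lborel)"
    using assms by (intro emeasure_distr) auto
  also have "(+) a -` S \<inter> space lborel = {t. t + a \<in> S}"
    by (auto simp: add.commute)
  finally show ?thesis
    by (simp add: lborel_distr_plus)
qed

text \<open>Moving the window from \<open>0\<close> to \<open>a\<close> loses \<open>{0..<a}\<close>
  and gains \<open>{c..<a + c}\<close>; these are translates of each other by the period. Half-open
  intervals make all the unions disjoint.\<close>

lemma emeasure_periodic_window:
  fixes S :: "real set"
  assumes S [measurable]: "S \<in> sets borel"
    and per: "\<And>t. t + c \<in> S \<longleftrightarrow> t \<in> S"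
    and a: "0 \<le> a" "a < c"
  shows "emeasure lborel ({a..<a + c} \<inter> S) = emeasure lborel ({0..<c} \<inter> S)"
proof -
  have *: "{t. t + c \<in> {c..<a + c} \<inter> S} = {0..<a} \<inter> S"
    using per by auto
  have "emeasure lborel ({c..<a + c} \<inter> S) = emeasure lborel ({0..<a} \<inter> S)"
    using emeasure_lborel_translate[of "{c..<a + c} \<inter> S" c] unfolding * by simp
  moreover have "{a..<a + c} \<inter> S = ({a..<c} \<inter> S) \<union> ({c..<a + c} \<inter> S)"
    and "{0..<c} \<inter> S = ({a..<c} \<inter> S) \<union> ({0..<a} \<inter> S)"
    using a by auto
  moreover have "emeasure lborel (({a..<c} \<inter> S) \<union> ({c..<a + c} \<inter> S)) =
      emeasure lborel ({a..<c} \<inter> S) + emeasure lborel ({c..<a + c} \<inter> S)"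
    by (rule plus_emeasure[symmetric]) auto
  moreover have "emeasure lborel (({a..<c} \<inter> S) \<union> ({0..<a} \<inter> S)) =
      emeasure lborel ({a..<c} \<inter> S) + emeasure lborel ({0..<a} \<inter> S)"
    by (rule plus_emeasure[symmetric]) auto
  ultimately show ?thesis
    by simp
qed

text \<open>Rotation invariance is stated for distributions, so that integrability and the value of
  the integral both transfer from one equation.\<close>

lemma distr_angle_shift:
  fixes f :: "real \<Rightarrow> real"
  assumes f [measurable]: "f \<in> borel_measurable borel"
    and per: "\<And>t. f (t + 2 * pi) = f t"
  shows "distr angle borel (\<lambda>t. f (t + a)) = distr angle borel f"
proof -
  interpret f: periodic_fun_simple f "2 * pi"
    by standard (rule per)
  \<comment> \<open>Whole periods are split off, since the window comparison covers only shifts in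
    \<open>[0, 2 * pi)\<close>.\<close>
  define k where "k = \<lfloor>a / (2 * pi)\<rfloor>"
  define b where "b = a - of_int k * (2 * pi)"
  have b: "0 \<le> b" "b < 2 * pi"
    using floor_divide_lower[of "2 * pi" a] floor_divide_upper[of "2 * pi" a]
    by (auto simp: b_def k_def algebra_simps)
  have fab: "f (t + a) = f (t + b)" for t
    using f.plus_of_int[of "t + b" k] by (simp add: b_def algebra_simps)
  show ?thesis
  proof (rule measure_eqI)
    fix A assume "A \<in> sets (distr angle borel (\<lambda>t. f (t + a)))"
    then have A [measurable]: "A \<in> sets borel" by simp
    define S where "S = f -` A"
    have S [measurable]: "S \<in> sets borel"
      unfolding S_def using measurable_sets_borel[OF f A] .
    have Sper: "t + 2 * pi \<in> S \<longleftrightarrow> t \<in> S" for t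
      by (simp add: S_def per)
    have Sb [measurable]: "{t. t + b \<in> S} \<in> sets borel" by measurable
    have *: "{0..<2 * pi} \<inter> {t. t + b \<in> S} = {t. t + b \<in> {b..<b + 2 * pi} \<inter> S}"
      by auto
    have "emeasure lborel ({0..<2 * pi} \<inter> {t. t + b \<in> S}) = emeasure lborel ({b..<b + 2 * pi} \<inter> S)"
      unfolding * by (rule emeasure_lborel_translate) auto
    also have "\<dots> = emeasure lborel ({0..<2 * pi} \<inter> S)"
      using Sper b by (intro emeasure_periodic_window) auto
    finally have "emeasure angle {t. t + b \<in> S} = emeasure angle S"
      unfolding angle_def by (subst (1 2) emeasure_uniform_measure) auto
    moreover have "emeasure (distr angle borel (\<lambda>t. f (t + a))) A = emeasure angle {t. t + b \<in> S}"
      by (subst emeasure_distr) (auto simp: fab S_def vimage_def)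
    moreover have "emeasure (distr angle borel f) A = emeasure angle S"
      by (subst emeasure_distr) (auto simp: S_def)
    ultimately show "emeasure (distr angle borel (\<lambda>t. f (t + a))) A = emeasure (distr angle borel f) A"
      by simp
  qed simp
qed

lemma
  fixes f :: "real \<Rightarrow> real"
  assumes f [measurable]: "f \<in> borel_measurable borel"
    and per: "\<And>t. f (t + 2 * pi) = f t"
  shows integral_angle_shift: "(\<integral>t. f (t + a) \<partial>angle) = (\<integral>t. f t \<partial>angle)"
    and integrable_angle_shift: "integrable angle (\<lambda>t. f (t + a)) \<longleftrightarrow> integrable angle f"
proof -
  note eq = distr_angle_shift[OF f per, of a]
  have "(\<integral>x. x \<partial>distr angle borel (\<lambda>t. f (t + a))) = (\<integral>t. f (t + a) \<partial>angle)"
    by (rule integral_distr) auto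
  moreover have "(\<integral>x. x \<partial>distr angle borel f) = (\<integral>t. f t \<partial>angle)"
    by (rule integral_distr) auto
  ultimately show "(\<integral>t. f (t + a) \<partial>angle) = (\<integral>t. f t \<partial>angle)"
    by (simp add: eq)
  have "integrable (distr angle borel (\<lambda>t. f (t + a))) (\<lambda>x. x) \<longleftrightarrow> integrable angle (\<lambda>t. f (t + a))"
    by (rule integrable_distr_eq) auto
  moreover have "integrable (distr angle borel f) (\<lambda>x. x) \<longleftrightarrow> integrable angle f"
    by (rule integrable_distr_eq) auto
  ultimately show "integrable angle (\<lambda>t. f (t + a)) \<longleftrightarrow> integrable angle f"
    by (simp add: eq)
qed

section \<open>Integrability of \<open>ln |cos t|\<close>\<close>

text \<open>Logarithms of products are split only almost everywhere: with \<open>ln 0 = 0\<close>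
  the functional equation fails at the zeros, which are countably many.\<close>

lemma AE_angle_cos_shift: "AE t in angle. cos (t + a) \<noteq> 0"
proof -
  have "countable {t. cos (t + a) = 0}"
  proof (rule countable_subset)
    show "{t. cos (t + a) = 0} \<subseteq> (\<lambda>i::int. of_int i * (pi/2) - a) ` UNIV"
    proof
      fix t assume "t \<in> {t. cos (t + a) = 0}"
      then obtain i :: int where "t + a = of_int i * (pi/2)"
        by (auto simp: cos_zero_iff_int)
      then show "t \<in> (\<lambda>i::int. of_int i * (pi/2) - a) ` UNIV"
        by (intro image_eqI[of _ _ i]) auto
    qed
  qed auto
  then have "AE t in lborel. t \<notin> {t. cos (t + a) = 0}"
    by (intro AE_not_in countable_imp_null_set_lborel)
  then show ?thesis
    unfolding angle_def by (intro AE_uniform_measureI) auto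
qed

text \<open>The majorant is chosen for its antiderivative: wherever \<open>sin\<close> keeps its
  sign, it is a constant multiple of the derivative of \<open>sqrt (cos t)\<close>. At zeros of
  \<open>cos\<close> both sides are \<open>0\<close> by convention.\<close>

lemma abs_ln_abs_cos_le: "\<bar>ln \<bar>cos t\<bar>\<bar> \<le> 2 * (\<bar>sin t\<bar> / sqrt \<bar>cos t\<bar>)"
proof (cases "cos t = 0")
  case False
  define s where "s = \<bar>cos t\<bar>"
  have s: "0 < s" "s \<le> 1" using False by (auto simp: s_def)
  \<comment> \<open>Applying \<open>ln u <= u - 1\<close> to \<open>1 / sqrt s\<close> leaves an
    integrable singularity; \<open>1 / s\<close> would not.\<close>
  have "ln (1 / sqrt s) \<le> 1 / sqrt s - 1"
    using s by (intro ln_le_minus_one) auto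
  then have "- ln s \<le> 2 * (1 / sqrt s - 1)"
    using s by (simp add: ln_div ln_sqrt)
  also have "1 / sqrt s - 1 = (1 - sqrt s) / sqrt s"
    using s by (simp add: field_simps)
  also have "\<dots> \<le> \<bar>sin t\<bar> / sqrt s"
  proof (rule divide_right_mono)
    have "s \<le> sqrt s" using s by (intro real_le_rsqrt) (simp add: power2_eq_square mult_left_le)
    moreover have "1 - s \<le> \<bar>sin t\<bar>"
    proof (rule power2_le_imp_le)
      have "(1 - s)\<^sup>2 \<le> 1 - s\<^sup>2" using s by (simp add: power2_eq_square algebra_simps mult_left_le)
      also have "\<dots> = \<bar>sin t\<bar>\<^sup>2" by (simp add: s_def sin_squared_eq)
      finally show "(1 - s)\<^sup>2 \<le> \<bar>sin t\<bar>\<^sup>2" .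
    qed auto
    ultimately show "1 - sqrt s \<le> \<bar>sin t\<bar>" by linarith
  qed (use s in auto)
  finally show ?thesis using s by (simp add: s_def)
qed auto

lemma integrable_on_abs_sin_over_sqrt_cos:
  "(\<lambda>t. \<bar>sin t\<bar> / sqrt \<bar>cos t\<bar>) integrable_on {0..2 * pi}"
proof -
  \<comment> \<open>The library's \<open>sqrt\<close> is odd, so this antiderivative is continuous across the zeros of \<open>cos\<close>.\<close>
  have D: "((\<lambda>t. - 2 * sqrt (cos t)) has_real_derivative (sin t / sqrt \<bar>cos t\<bar>)) (at t)"
    if "cos t \<noteq> 0" for t
  proof -
    have "(sqrt has_real_derivative (inverse (sqrt \<bar>cos t\<bar>) / 2)) (at (cos t))"
      using that by (intro DERIV_real_sqrt_generic) (auto simp: abs_if real_sqrt_minus)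
    then have "((\<lambda>t. sqrt (cos t)) has_real_derivative (inverse (sqrt \<bar>cos t\<bar>) / 2 * - sin t)) (at t)"
      by (rule DERIV_chain2) (rule DERIV_cos)
    then have "((\<lambda>t. - 2 * sqrt (cos t)) has_real_derivative
        (- 2 * (inverse (sqrt \<bar>cos t\<bar>) / 2 * - sin t))) (at t)"
      by (rule DERIV_cmult)
    moreover have "- 2 * (inverse (sqrt \<bar>cos t\<bar>) / 2 * - sin t) = sin t / sqrt \<bar>cos t\<bar>"
      by (simp add: field_simps)
    ultimately show ?thesis
      by (simp only:)
  qed
  \<comment> \<open>These zeros form the exceptional set of the fundamental theorem of calculus,
    where continuity of the antiderivative is enough.\<close>
  have *: "finite {t. a \<le> t \<and> t \<le> b \<and> cos t = 0}" for a b :: real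
  proof (rule finite_subset)
    show "{t. a \<le> t \<and> t \<le> b \<and> cos t = 0} \<subseteq> (\<lambda>i::int. of_int i * (pi/2)) ` {\<lceil>a / (pi/2)\<rceil>..\<lfloor>b / (pi/2)\<rfloor>}"
    proof
      fix t assume t: "t \<in> {t. a \<le> t \<and> t \<le> b \<and> cos t = 0}"
      then obtain i :: int where i: "t = of_int i * (pi/2)"
        by (auto simp: cos_zero_iff_int)
      have "a / (pi/2) \<le> of_int i" "of_int i \<le> b / (pi/2)"
        using t i by (auto simp: field_simps)
      then show "t \<in> (\<lambda>i::int. of_int i * (pi/2)) ` {\<lceil>a / (pi/2)\<rceil>..\<lfloor>b / (pi/2)\<rfloor>}"
        using i by (intro image_eqI[where x = i]) (auto simp: ceiling_le_iff le_floor_iff)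
    qed
  qed auto
  have I: "(\<lambda>t. sin t / sqrt \<bar>cos t\<bar>) integrable_on {a..b}" if "a \<le> b" for a b
    unfolding integrable_on_def
    by (rule exI, rule fundamental_theorem_of_calculus_strong[OF *[of a b] that])
       (use D in \<open>auto intro!: continuous_intros simp: has_real_derivative_iff_has_vector_derivative[symmetric]\<close>)
  have "(\<lambda>t. \<bar>sin t\<bar> / sqrt \<bar>cos t\<bar>) integrable_on {0..pi}"
    by (rule integrable_eq[OF I]) (auto simp: sin_ge_zero)
  moreover have "(\<lambda>t. \<bar>sin t\<bar> / sqrt \<bar>cos t\<bar>) integrable_on {pi..2*pi}"
    by (rule integrable_eq[OF integrable_neg[OF I]]) (use sin_le_zero in \<open>force+\<close>)
  ultimately show ?thesis
    by (intro Henstock_Kurzweil_Integration.integrable_combine[of 0 pi "2*pi"]) auto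
qed

lemma integrable_angleI:
  fixes f :: "real \<Rightarrow> real"
  assumes [measurable]: "f \<in> borel_measurable borel"
    and "set_integrable lborel {0..2 * pi} f"
  shows "integrable angle f"
proof -
  have "set_integrable lborel {0..<2*pi} f"
    using assms(2) by (rule set_integrable_subset) auto
  then have "integrable lborel (\<lambda>x. (1 / (2 * pi)) * (indicator {0..<2*pi} x * f x))"
    by (simp add: set_integrable_def)
  also have "(\<lambda>x. (1 / (2 * pi)) * (indicator {0..<2*pi} x * f x)) =
      (\<lambda>x. (indicator {0..<2*pi} x / (2 * pi)) *\<^sub>R f x)"
    by auto
  finally have "integrable (density lborel (\<lambda>x. ennreal (indicator {0..<2*pi} x / (2 * pi)))) f"
    by (subst integrable_density) auto
  moreover have "angle = density lborel (\<lambda>x. ennreal (indicator {0..<2*pi} x / (2 * pi)))"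
    unfolding angle_def uniform_measure_def
    by (auto intro!: arg_cong[where f = "density lborel"]
        simp: fun_eq_iff divide_ennreal indicator_def ennreal_1[symmetric] simp del: ennreal_1)
  ultimately show ?thesis
    by simp
qed

lemma integrable_ln_abs_cos: "integrable angle (\<lambda>t. ln \<bar>cos t\<bar>)"
proof (rule Bochner_Integration.integrable_bound)
  have "(\<lambda>t. \<bar>sin t\<bar> / sqrt \<bar>cos t\<bar>) absolutely_integrable_on {0..2 * pi}"
    by (intro nonnegative_absolutely_integrable_1 integrable_on_abs_sin_over_sqrt_cos) auto
  \<comment> \<open>Absolute integrability refers to the completed measure; Borel measurability
    brings it down to \<open>lborel\<close>.\<close>
  then have "set_integrable lborel {0..2 * pi} (\<lambda>t. \<bar>sin t\<bar> / sqrt \<bar>cos t\<bar>)"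
    unfolding set_integrable_def by (subst (asm) integrable_completion) auto
  then show "integrable angle (\<lambda>t. 2 * (\<bar>sin t\<bar> / sqrt \<bar>cos t\<bar>))"
    by (intro integrable_mult_right integrable_angleI) auto
qed (use abs_ln_abs_cos_le in auto)

section \<open>Logarithmic averages over the circle\<close>

text \<open>
  The factors on the left are \<open>\<bar>sin (t + b)\<bar>\<close> and \<open>\<bar>sin (t - b)\<bar>\<close>, and \<open>\<bar>cos (t + pi) + cos b\<bar>\<close> is
  \<open>\<bar>cos t - cos b\<bar>\<close>; written as shifts, they reduce on average to a single function each.
\<close>

lemma abs_cos_shift_mult_abs_cos_shift:
  fixes t b :: real
  shows "\<bar>cos (t + (b - pi/2))\<bar> * \<bar>cos (t + (- b - pi/2))\<bar> = \<bar>cos t + cos b\<bar> * \<bar>cos (t + pi) + cos b\<bar>"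
proof -
  have "cos (t + (b - pi/2)) = sin (t + b)" "cos (t + (- b - pi/2)) = sin (t - b)"
    using cos_minus[of "pi/2 - (t + b)"] cos_minus[of "pi/2 - (t - b)"]
    by (simp_all add: cos_diff cos_add sin_add sin_diff)
  moreover have "sin (t + b) * sin (t - b) = (cos t + cos b) * (cos (t + pi) + cos b)"
    by (simp add: sin_add sin_diff cos_add sin_squared_eq algebra_simps power2_eq_square[symmetric])
  ultimately show ?thesis
    by (simp flip: abs_mult)
qed

text \<open>With \<open>y = cos b\<close>, the logarithm of the product identity says that
  \<open>F t + F (t + pi)\<close> is a sum of two shifts of \<open>L\<close>. By rotation invariance
  the averages of the two sides are twice those of \<open>F\<close> and of \<open>L\<close>.\<close>

lemma
  assumes y: "\<bar>y\<bar> \<le> 1"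
  shows AE_cos_add_neq_0: "AE t in angle. cos (t + a) + y \<noteq> 0"
    and integrable_ln_abs_cos_add: "integrable angle (\<lambda>t. ln \<bar>cos t + y\<bar>)"
    and integral_ln_abs_cos_add:
      "(\<integral>t. ln \<bar>cos t + y\<bar> \<partial>angle) = (\<integral>t. ln \<bar>cos t\<bar> \<partial>angle)"
    and integral_abs_ln_abs_cos_add_le:
      "(\<integral>t. \<bar>ln \<bar>cos t + y\<bar>\<bar> \<partial>angle) \<le> ln 2 + 2 * (\<integral>t. \<bar>ln \<bar>cos t\<bar>\<bar> \<partial>angle)"
proof -
  define b where "b = arccos y"
  have cb: "cos b = y"
    using y unfolding b_def by (intro cos_arccos) auto
  define L where "L = (\<lambda>t. ln \<bar>cos t :: real\<bar>)"
  define F where "F = (\<lambda>t. ln \<bar>cos t + y\<bar>)"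
  have [measurable]: "L \<in> borel_measurable borel" "F \<in> borel_measurable borel"
    unfolding L_def F_def by measurable
  have per: "L (t + 2 * pi) = L t" "F (t + 2 * pi) = F t" for t
    by (simp_all add: L_def F_def)
  have L: "integrable angle (\<lambda>t. L (t + c))" for c
    using integrable_ln_abs_cos by (subst integrable_angle_shift) (auto simp: per, simp add: L_def)
  have prod: "\<bar>cos (t + (b - pi/2))\<bar> * \<bar>cos (t + (- b - pi/2))\<bar> = \<bar>cos t + y\<bar> * \<bar>cos (t + pi) + y\<bar>" for t
    using abs_cos_shift_mult_abs_cos_shift[of t b] by (simp add: cb)
  \<comment> \<open>The left side of \<open>prod\<close> is nonzero almost everywhere, hence so is
    each factor on the right.\<close>
  show "AE t in angle. cos (t + a) + y \<noteq> 0" for a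
    using AE_angle_cos_shift[of "a + (b - pi/2)"] AE_angle_cos_shift[of "a + (- b - pi/2)"]
  proof eventually_elim
    case (elim t)
    then show ?case
      using prod[of "t + a"] by (auto simp: add.assoc)
  qed
  note ne = this[of 0, simplified] this[of pi]
  have eq: "AE t in angle. F t + F (t + pi) = L (t + (b - pi/2)) + L (t + (- b - pi/2))"
    using AE_angle_cos_shift[of "b - pi/2"] AE_angle_cos_shift[of "- b - pi/2"] ne
  proof eventually_elim
    case (elim t)
    then show ?case
      using arg_cong[OF prod[of t], of ln] by (simp add: F_def L_def ln_mult)
  qed
  have F_le: "F t \<le> ln 2" if "cos t + y \<noteq> 0" for t
  proof -
    have "\<bar>cos t + y\<bar> \<le> 2"
      using y abs_cos_le_one[of t] by linarith
    with that show ?thesis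
      by (simp add: F_def)
  qed
  have le: "AE t in angle. F t \<le> ln 2 \<and> F (t + pi) \<le> ln 2"
    using ne by eventually_elim (blast intro: F_le)
  \<comment> \<open>The upper bound \<open>F <= ln 2\<close> yields a lower one as well: by
    \<open>eq\<close>, \<open>F t\<close> is the sum of the two \<open>L\<close> terms minus
    \<open>F (t + pi)\<close>, and the latter is at most \<open>ln 2\<close>.\<close>
  have bound: "AE t in angle. \<bar>F t\<bar> \<le> ln 2 + (\<bar>L (t + (b - pi/2))\<bar> + \<bar>L (t + (- b - pi/2))\<bar>)"
    using eq le
  proof eventually_elim
    case (elim t)
    then show ?case using ln_gt_zero[of 2] by linarith
  qed
  have I: "integrable angle (\<lambda>t. ln 2 + (\<bar>L (t + (b - pi/2))\<bar> + \<bar>L (t + (- b - pi/2))\<bar>))"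
    using L by (intro Bochner_Integration.integrable_add integrable_abs) auto
  have F: "integrable angle F"
  proof (rule Bochner_Integration.integrable_bound[OF I])
    show "AE t in angle. norm (F t) \<le> norm (ln 2 + (\<bar>L (t + (b - pi/2))\<bar> + \<bar>L (t + (- b - pi/2))\<bar>))"
      using bound by eventually_elim auto
  qed auto
  then show "integrable angle (\<lambda>t. ln \<bar>cos t + y\<bar>)"
    by (simp add: F_def)
  have Fpi: "integrable angle (\<lambda>t. F (t + pi))"
    using F by (subst integrable_angle_shift) (auto simp: per)
  have "(\<integral>t. F t + F (t + pi) \<partial>angle) = (\<integral>t. L (t + (b - pi/2)) + L (t + (- b - pi/2)) \<partial>angle)"
    by (rule integral_cong_AE[OF _ _ eq]) auto
  then have "(\<integral>t. F t \<partial>angle) + (\<integral>t. F t \<partial>angle) = (\<integral>t. L t \<partial>angle) + (\<integral>t. L t \<partial>angle)"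
    using F Fpi L by (simp add: integral_angle_shift per)
  then show "(\<integral>t. ln \<bar>cos t + y\<bar> \<partial>angle) = (\<integral>t. ln \<bar>cos t\<bar> \<partial>angle)"
    by (simp add: F_def L_def)
  have "(\<integral>t. \<bar>F t\<bar> \<partial>angle) \<le> (\<integral>t. ln 2 + (\<bar>L (t + (b - pi/2))\<bar> + \<bar>L (t + (- b - pi/2))\<bar>) \<partial>angle)"
    using F I bound by (intro integral_mono_AE) auto
  also have "\<dots> = ln 2 + ((\<integral>t. \<bar>L t\<bar> \<partial>angle) + (\<integral>t. \<bar>L t\<bar> \<partial>angle))"
    using L integral_angle_shift[of "\<lambda>t. \<bar>L t\<bar>"] by (simp add: per angle.prob_space[simplified])
  finally show "(\<integral>t. \<bar>ln \<bar>cos t + y\<bar>\<bar> \<partial>angle) \<le> ln 2 + 2 * (\<integral>t. \<bar>ln \<bar>cos t\<bar>\<bar> \<partial>angle)"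
    by (simp add: F_def L_def)
qed

text \<open>Factoring out \<open>r\<close> reduces everything to \<open>y = w / r\<close>. The last
  bound is uniform in \<open>w\<close>, so it survives when \<open>w\<close> varies with a second
  angle, as Fubini on the torus requires.\<close>

lemma
  assumes r: "0 < r" and w: "\<bar>w\<bar> \<le> r"
  shows AE_cos_affine_neq_0: "AE t in angle. r * cos (t + a) + w \<noteq> 0"
    and integrable_ln_abs_cos_affine: "integrable angle (\<lambda>t. ln \<bar>r * cos (t + a) + w\<bar>)"
    and integral_ln_abs_cos_affine:
      "(\<integral>t. ln \<bar>r * cos (t + a) + w\<bar> \<partial>angle) = ln r + (\<integral>t. ln \<bar>cos t\<bar> \<partial>angle)"
    and integral_abs_ln_abs_cos_affine_le:
      "(\<integral>t. \<bar>ln \<bar>r * cos (t + a) + w\<bar>\<bar> \<partial>angle) \<le> \<bar>ln r\<bar> + ln 2 + 2 * (\<integral>t. \<bar>ln \<bar>cos t\<bar>\<bar> \<partial>angle)"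
proof -
  define y where "y = w / r"
  have y: "\<bar>y\<bar> \<le> 1" and wy: "w = r * y"
    using r w by (auto simp: y_def field_simps)
  have factor: "r * cos t + w = r * (cos t + y)" for t
    by (simp add: wy algebra_simps)
  show ne: "AE t in angle. r * cos (t + a) + w \<noteq> 0"
    using AE_cos_add_neq_0[OF y, of a] r by (simp add: factor)
  have eq: "AE t in angle. ln \<bar>r * cos (t + a) + w\<bar> = ln r + ln \<bar>cos (t + a) + y\<bar>"
    using AE_cos_add_neq_0[OF y, of a]
    by eventually_elim (use r in \<open>simp add: factor abs_mult ln_mult\<close>)
  have I: "integrable angle (\<lambda>t. ln \<bar>cos (t + a) + y\<bar>)"
    using integrable_ln_abs_cos_add[OF y] by (subst integrable_angle_shift) auto
  then show J: "integrable angle (\<lambda>t. ln \<bar>r * cos (t + a) + w\<bar>)"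
    by (subst integrable_cong_AE[OF _ _ eq]) auto
  have "(\<integral>t. ln \<bar>r * cos (t + a) + w\<bar> \<partial>angle) = (\<integral>t. ln r + ln \<bar>cos (t + a) + y\<bar> \<partial>angle)"
    by (rule integral_cong_AE[OF _ _ eq]) auto
  also have "\<dots> = ln r + (\<integral>t. ln \<bar>cos (t + a) + y\<bar> \<partial>angle)"
    using I by (simp add: angle.prob_space[simplified])
  also have "(\<integral>t. ln \<bar>cos (t + a) + y\<bar> \<partial>angle) = (\<integral>t. ln \<bar>cos t + y\<bar> \<partial>angle)"
    by (rule integral_angle_shift) auto
  finally show "(\<integral>t. ln \<bar>r * cos (t + a) + w\<bar> \<partial>angle) = ln r + (\<integral>t. ln \<bar>cos t\<bar> \<partial>angle)"
    by (simp add: integral_ln_abs_cos_add[OF y])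
  have "(\<integral>t. \<bar>ln \<bar>r * cos (t + a) + w\<bar>\<bar> \<partial>angle) \<le> (\<integral>t. \<bar>ln r\<bar> + \<bar>ln \<bar>cos (t + a) + y\<bar>\<bar> \<partial>angle)"
    using J I by (intro integral_mono_AE) (use eq in \<open>auto elim!: eventually_mono\<close>)
  also have "\<dots> = \<bar>ln r\<bar> + (\<integral>t. \<bar>ln \<bar>cos (t + a) + y\<bar>\<bar> \<partial>angle)"
    using I by (simp add: angle.prob_space[simplified])
  also have "(\<integral>t. \<bar>ln \<bar>cos (t + a) + y\<bar>\<bar> \<partial>angle) = (\<integral>t. \<bar>ln \<bar>cos t + y\<bar>\<bar> \<partial>angle)"
    by (rule integral_angle_shift[of "\<lambda>t. \<bar>ln \<bar>cos t + y\<bar>\<bar>"]) auto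
  finally show "(\<integral>t. \<bar>ln \<bar>r * cos (t + a) + w\<bar>\<bar> \<partial>angle) \<le> \<bar>ln r\<bar> + ln 2 + 2 * (\<integral>t. \<bar>ln \<bar>cos t\<bar>\<bar> \<partial>angle)"
    using integral_abs_ln_abs_cos_add_le[OF y] by simp
qed

section \<open>Strict comparison of averages of \<open>p\<close>-th powers\<close>

lemma integral_angle_pos:
  fixes f :: "real \<Rightarrow> real"
  assumes cont: "continuous_on UNIV f" and int: "integrable angle f" and nonneg: "\<And>t. 0 \<le> f t"
    and x: "0 \<le> x" "x < 2 * pi" "0 < f x"
  shows "0 < (\<integral>t. f t \<partial>angle)"
proof (rule ccontr)
  assume "\<not> 0 < (\<integral>t. f t \<partial>angle)"
  moreover have "0 \<le> (\<integral>t. f t \<partial>angle)"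
    using nonneg by simp
  ultimately have "(\<integral>t. f t \<partial>angle) = 0"
    by simp
  then have "AE t in angle. f t = 0"
    using nonneg int by (subst (asm) integral_nonneg_eq_0_iff_AE) auto
  then have ae: "AE t in lborel. t \<in> {0..<2 * pi} \<longrightarrow> f t = 0"
    unfolding angle_def by (subst (asm) AE_uniform_measure) auto
  have "open {t. 0 < f t}"
    using cont by (intro open_Collect_less) auto
  then obtain d where d: "0 < d" "\<And>t. dist t x < d \<Longrightarrow> 0 < f t"
    using x by (auto simp: open_dist)
  \<comment> \<open>The cut at \<open>2 * pi\<close> keeps the interval where \<open>angle\<close>
    has its mass; \<open>x < 2 * pi\<close> keeps it nonempty.\<close>
  define m where "m = min (x + d) (2 * pi)"
  have m: "x < m"
    using d x by (simp add: m_def)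
  have "AE t in lborel. t \<notin> {x<..<m}"
    using ae
  proof eventually_elim
    case (elim t)
    show ?case
    proof
      assume "t \<in> {x<..<m}"
      then have "0 < f t" "t \<in> {0..<2 * pi}"
        using x by (auto simp: m_def dist_real_def intro!: d(2))
      with elim show False by simp
    qed
  qed
  then have "{x<..<m} \<in> null_sets lborel"
    by (subst AE_iff_null_sets) auto
  then have "emeasure lborel {x<..<m} = 0"
    by auto
  with m show False
    by simp
qed

text \<open>At equal products, the larger sum of squares gives both the larger sum and the larger
  difference, hence the larger maximum. Writing \<open>A\<close>, \<open>B\<close>,
  \<open>C\<close>, \<open>D\<close> for the \<open>p\<close>-th powers, so that
  \<open>A * B = C * D\<close>, the claim follows from
  \<open>A * (A + B - C - D) = (A - C) * (A - D)\<close>, where both factors on the right are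
  nonnegative.\<close>

lemma powr_sum_mono_of_eq_prod:
  fixes u v u' v' :: real
  assumes nonneg: "0 \<le> u" "0 \<le> v" "0 \<le> u'" "0 \<le> v'"
    and prod: "u * v = u' * v'" and sq: "u'\<^sup>2 + v'\<^sup>2 \<le> u\<^sup>2 + v\<^sup>2" and p: "0 < p"
  shows "u' powr p + v' powr p \<le> u powr p + v powr p"
proof -
  have ordered: "c powr p + d powr p \<le> a powr p + b powr p"
    if ab: "0 \<le> b" "b \<le> a" and cd: "0 \<le> d" "d \<le> c" and eq: "a * b = c * d"
      and le: "c\<^sup>2 + d\<^sup>2 \<le> a\<^sup>2 + b\<^sup>2" for a b c d :: real
  proof -
    have "c + d \<le> a + b"
      by (rule power2_le_imp_le) (use ab cd eq le in \<open>auto simp: power2_sum\<close>)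
    moreover have "c - d \<le> a - b"
      by (rule power2_le_imp_le) (use ab cd eq le in \<open>auto simp: power2_diff\<close>)
    ultimately have ca: "c \<le> a" by linarith
    show ?thesis
    proof (cases "a = 0")
      case True
      with ab cd ca have "c = 0" "d = 0" by auto
      then show ?thesis by simp
    next
      case False
      have ge: "c powr p \<le> a powr p" "d powr p \<le> c powr p" and a: "0 < a powr p"
        using ca ab cd p False by (auto intro: powr_mono2)
      have "a powr p * b powr p = c powr p * d powr p"
        using ab cd eq by (simp flip: powr_mult)
      then have "a powr p * (a powr p + b powr p - c powr p - d powr p)
          = (a powr p - c powr p) * (a powr p - d powr p)"
        by (simp add: algebra_simps)
      also have "\<dots> \<ge> 0"
        using ge by simp
      finally show ?thesis
        using a by (simp add: zero_le_mult_iff)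
    qed
  qed
  have sorted: "max a b * min a b = a * b" "(max a b)\<^sup>2 + (min a b)\<^sup>2 = a\<^sup>2 + b\<^sup>2"
    "max a b powr p + min a b powr p = a powr p + b powr p" for a b :: real
    by (auto simp: max_def min_def)
  show ?thesis
    using ordered[of "min u v" "max u v" "min u' v'" "max u' v'"] nonneg prod sq
    by (simp add: sorted)
qed

lemma integrable_abs_cos_affine_powr:
  assumes "0 \<le> p"
  shows "integrable angle (\<lambda>t. \<bar>A * cos (t + a) + B\<bar> powr p)"
proof (rule angle.integrable_const_bound[where B = "(\<bar>A\<bar> + \<bar>B\<bar>) powr p"])
  have "\<bar>A * cos t + B\<bar> \<le> \<bar>A\<bar> + \<bar>B\<bar>" for t
  proof -
    have "\<bar>A * cos t\<bar> \<le> \<bar>A\<bar>"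
      by (simp add: abs_mult mult_left_le)
    then show ?thesis by linarith
  qed
  then show "AE t in angle. norm (\<bar>A * cos (t + a) + B\<bar> powr p) \<le> (\<bar>A\<bar> + \<bar>B\<bar>) powr p"
    using assms by (intro always_eventually allI) (auto intro!: powr_mono2)
qed auto

text \<open>The difference \<open>D\<close> of the two sums of powers is continuous and nonnegative
  by the preceding comparison, and its average is twice the gap sought. Strictness needs one point
  where \<open>D\<close> is positive.\<close>

lemma integral_abs_cos_add_powr_gt_aux:
  assumes p: "0 < p" and y: "0 < y" "y \<le> 1"
  shows "(\<integral>t. \<bar>cos t\<bar> powr p \<partial>angle) < (\<integral>t. \<bar>cos t + y\<bar> powr p \<partial>angle)"
proof -
  define b where "b = arccos y"
  have cb: "cos b = y"
    using y unfolding b_def by (intro cos_arccos) auto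
  have b: "0 \<le> b" "b \<le> pi"
    using y unfolding b_def by (auto intro: arccos_lbound arccos_ubound)
  define L where "L = (\<lambda>t. \<bar>cos t :: real\<bar> powr p)"
  define F where "F = (\<lambda>t. \<bar>cos t + y\<bar> powr p)"
  define D where "D = (\<lambda>t. (F t + F (t + pi)) - (L (t + (b - pi/2)) + L (t + (- b - pi/2))))"
  have [measurable]: "L \<in> borel_measurable borel" "F \<in> borel_measurable borel"
    unfolding L_def F_def by measurable
  have per: "L (t + 2 * pi) = L t" "F (t + 2 * pi) = F t" for t
    by (simp_all add: L_def F_def)
  have I: "integrable angle (\<lambda>t. L (t + c))" "integrable angle (\<lambda>t. F (t + c))" for c
    using integrable_abs_cos_affine_powr[of p 1 c 0] integrable_abs_cos_affine_powr[of p 1 c y] p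
    by (simp_all add: L_def F_def)
  have I0: "integrable angle L" "integrable angle F"
    using I[of 0] by simp_all
  have sincos: "cos (t + (b - pi/2)) = sin (t + b)" "cos (t + (- b - pi/2)) = sin (t - b)" for t
    using cos_minus[of "pi/2 - (t + b)"] cos_minus[of "pi/2 - (t - b)"]
    by (simp_all add: cos_diff cos_add sin_add sin_diff)
  have "0 \<le> D t" for t
  proof -
    have "(sin (t + b))\<^sup>2 + (sin (t - b))\<^sup>2 \<le> (cos t + y)\<^sup>2 + (cos (t + pi) + y)\<^sup>2"
    proof -
      have "(cos t + y)\<^sup>2 + (cos (t + pi) + y)\<^sup>2 - ((sin (t + b))\<^sup>2 + (sin (t - b))\<^sup>2)
          = 4 * (cos t)\<^sup>2 * (cos b)\<^sup>2"
        by (simp add: sin_add sin_diff cos_add cb[symmetric] power2_sum power2_diff power_mult_distrib sin_squared_eq)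
           (simp add: algebra_simps)
      also have "\<dots> \<ge> 0" by simp
      finally show ?thesis by simp
    qed
    then have "L (t + (b - pi/2)) + L (t + (- b - pi/2)) \<le> F t + F (t + pi)"
      unfolding L_def F_def using abs_cos_shift_mult_abs_cos_shift[of t b] p
      by (intro powr_sum_mono_of_eq_prod) (auto simp: sincos cb)
    then show ?thesis by (simp add: D_def)
  qed
  \<comment> \<open>At \<open>t = b\<close> both products vanish, so each pair has one zero entry.
    The others are \<open>2 * y\<close> and \<open>|sin (b + b)| = 2 * y * |sin b|\<close>, and
    \<open>y > 0\<close> forces \<open>|sin b| < 1\<close>.\<close>
  moreover have "0 < D b"
  proof -
    have s: "\<bar>sin b\<bar> < 1"
    proof -
      have "(sin b)\<^sup>2 < 1" using y by (simp add: sin_squared_eq cb)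
      then show ?thesis by (simp add: abs_square_less_1)
    qed
    have "\<bar>sin (b + b)\<bar> = 2 * y * \<bar>sin b\<bar>"
      using y by (simp add: sin_double cb abs_mult)
    also have "\<dots> < 2 * y"
      using y s by simp
    finally have "\<bar>sin (b + b)\<bar> powr p < (2 * y) powr p"
      using p by (intro powr_less_mono2) auto
    then show ?thesis
      using y p by (simp add: D_def F_def L_def sincos cb)
  qed
  moreover have "continuous_on UNIV D"
  proof -
    have cont: "continuous_on UNIV (\<lambda>t. \<bar>cos (t + c) + w\<bar> powr p)" for c w :: real
      using p by (intro continuous_on_powr') (auto intro!: continuous_intros)
    show ?thesis
      unfolding D_def F_def L_def
      using cont[of 0 y] cont[of pi y] cont[of _ 0]
      by (intro continuous_on_diff continuous_on_add) simp_all
  qed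
  moreover have "integrable angle D"
    unfolding D_def using I I0 by (intro Bochner_Integration.integrable_diff Bochner_Integration.integrable_add)
  ultimately have "0 < (\<integral>t. D t \<partial>angle)"
    using b by (intro integral_angle_pos[of D b]) (auto intro: order.strict_trans1)
  also have "(\<integral>t. D t \<partial>angle) = 2 * ((\<integral>t. F t \<partial>angle) - (\<integral>t. L t \<partial>angle))"
    unfolding D_def using I I0 by (simp add: integral_angle_shift per)
  finally show ?thesis
    by (simp add: F_def L_def)
qed

text \<open>Above \<open>1\<close> no \<open>arccos\<close> exists, but \<open>cos t + z\<close> is
  nonnegative and increasing in \<open>z\<close> from \<open>z = 1\<close> on, so the value at
  \<open>1\<close> is a lower bound. Negative \<open>y\<close> is reflected by the shift
  \<open>t + pi\<close>.\<close>

lemma integral_abs_cos_add_powr_gt: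
  assumes p: "0 < p" and y: "y \<noteq> 0"
  shows "(\<integral>t. \<bar>cos t\<bar> powr p \<partial>angle) < (\<integral>t. \<bar>cos t + y\<bar> powr p \<partial>angle)"
proof -
  have pos: "(\<integral>t. \<bar>cos t\<bar> powr p \<partial>angle) < (\<integral>t. \<bar>cos t + z\<bar> powr p \<partial>angle)" if z: "0 < z" for z
  proof (cases "z \<le> 1")
    case True
    with integral_abs_cos_add_powr_gt_aux[OF p z] show ?thesis .
  next
    case False
    have "(\<integral>t. \<bar>cos t\<bar> powr p \<partial>angle) < (\<integral>t. \<bar>cos t + 1\<bar> powr p \<partial>angle)"
      using integral_abs_cos_add_powr_gt_aux[OF p, of 1] by simp
    also have "\<dots> \<le> (\<integral>t. \<bar>cos t + z\<bar> powr p \<partial>angle)"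
    proof (rule integral_mono)
      show "integrable angle (\<lambda>t. \<bar>cos t + 1\<bar> powr p)" "integrable angle (\<lambda>t. \<bar>cos t + z\<bar> powr p)"
        using integrable_abs_cos_affine_powr[of p 1 0] p by simp_all
      show "\<bar>cos t + 1\<bar> powr p \<le> \<bar>cos t + z\<bar> powr p" for t
        using cos_ge_minus_one[of t] False p by (intro powr_mono2) linarith+
    qed
    finally show ?thesis .
  qed
  show ?thesis
  proof (cases "0 < y")
    case True
    then show ?thesis by (rule pos)
  next
    case False
    have "(\<integral>t. \<bar>cos t + - y\<bar> powr p \<partial>angle) = (\<integral>t. \<bar>cos (t + pi) + - y\<bar> powr p \<partial>angle)"
      by (rule integral_angle_shift[symmetric, of "\<lambda>t. \<bar>cos t + - y\<bar> powr p"]) auto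
    also have "\<dots> = (\<integral>t. \<bar>cos t + y\<bar> powr p \<partial>angle)"
      by (intro Bochner_Integration.integral_cong refl arg_cong[where f = "\<lambda>x. x powr p"]) (simp add: abs_if)
    finally show ?thesis
      using pos[of "- y"] False y by simp
  qed
qed

text \<open>In the application \<open>A\<close> is the polar amplitude of the first two coordinates
  of a point on the sphere; it may be zero, which rules out dividing by it uniformly.\<close>

lemma integral_abs_cos_affine_powr_gt:
  assumes p: "0 < p" and B: "B \<noteq> 0"
  shows "(\<integral>t. \<bar>A * cos (t + a)\<bar> powr p \<partial>angle) < (\<integral>t. \<bar>A * cos (t + a) + B\<bar> powr p \<partial>angle)"
proof (cases "A = 0")
  case True
  then show ?thesis
    using p B by (simp add: angle.prob_space[simplified])
next
  case False
  have eq: "(\<integral>t. \<bar>A * cos (t + a) + C\<bar> powr p \<partial>angle) = \<bar>A\<bar> powr p * (\<integral>t. \<bar>cos t + C / A\<bar> powr p \<partial>angle)" for C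
  proof -
    have "(\<integral>t. \<bar>A * cos (t + a) + C\<bar> powr p \<partial>angle) = (\<integral>t. \<bar>A\<bar> powr p * \<bar>cos (t + a) + C / A\<bar> powr p \<partial>angle)"
    proof (intro Bochner_Integration.integral_cong refl)
      fix t
      have "A * cos (t + a) + C = A * (cos (t + a) + C / A)"
        using False by (simp add: algebra_simps)
      then show "\<bar>A * cos (t + a) + C\<bar> powr p = \<bar>A\<bar> powr p * \<bar>cos (t + a) + C / A\<bar> powr p"
        by (simp add: abs_mult powr_mult)
    qed
    also have "\<dots> = \<bar>A\<bar> powr p * (\<integral>t. \<bar>cos (t + a) + C / A\<bar> powr p \<partial>angle)"
      by simp
    also have "(\<integral>t. \<bar>cos (t + a) + C / A\<bar> powr p \<partial>angle) = (\<integral>t. \<bar>cos t + C / A\<bar> powr p \<partial>angle)"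
      by (rule integral_angle_shift) auto
    finally show ?thesis .
  qed
  show ?thesis
    using integral_abs_cos_add_powr_gt[OF p, of "B / A"] eq[of 0] eq[of B] False B by simp
qed

section \<open>Logarithmic averages over the torus\<close>

interpretation angle_pair: pair_prob_space angle angle ..

text \<open>Integrating first over the angle with the larger amplitude \<open>r\<close>, the other
  term is a constant of modulus at most \<open>r\<close>. The inner integral is then independent of
  the outer angle.\<close>

lemma
  fixes a c :: real
  assumes q: "0 \<le> q" "q \<le> r" and r: "0 < r"
  shows AE_torus_neq_0_aux: "AE z in angle \<Otimes>\<^sub>M angle. q * cos (fst z + c) + r * cos (snd z + a) \<noteq> 0"
    and integrable_torus_aux:
      "integrable (angle \<Otimes>\<^sub>M angle) (\<lambda>z. ln \<bar>q * cos (fst z + c) + r * cos (snd z + a)\<bar>)"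
    and integral_torus_aux:
      "(\<integral>z. ln \<bar>q * cos (fst z + c) + r * cos (snd z + a)\<bar> \<partial>(angle \<Otimes>\<^sub>M angle)) =
        ln r + (\<integral>t. ln \<bar>cos t\<bar> \<partial>angle)"
proof -
  let ?f = "\<lambda>z. ln \<bar>q * cos (fst z + c) + r * cos (snd z + a)\<bar>"
  have w: "\<bar>q * cos (s + c)\<bar> \<le> r" for s
    using q mult_left_le[of "\<bar>cos (s + c)\<bar>" q] by (simp add: abs_mult)
  have comm: "q * cos (s + c) + r * cos (t + a) = r * cos (t + a) + q * cos (s + c)" for s t
    by simp
  show "AE z in angle \<Otimes>\<^sub>M angle. q * cos (fst z + c) + r * cos (snd z + a) \<noteq> 0"
  proof (rule angle_pair.AE_pair_measure)
    show "AE s in angle. AE t in angle. q * cos (fst (s, t) + c) + r * cos (snd (s, t) + a) \<noteq> 0"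
      using AE_cos_affine_neq_0[OF r w] by (simp add: comm)
  qed measurable
  show int: "integrable (angle \<Otimes>\<^sub>M angle) ?f"
  proof (rule angle_pair.Fubini_integrable)
    show "integrable angle (\<lambda>s. \<integral>t. norm (?f (s, t)) \<partial>angle)"
    proof (rule angle.integrable_const_bound)
      show "AE s in angle. norm (\<integral>t. norm (?f (s, t)) \<partial>angle) \<le>
          \<bar>ln r\<bar> + ln 2 + 2 * (\<integral>t. \<bar>ln \<bar>cos t\<bar>\<bar> \<partial>angle)"
        using integral_abs_ln_abs_cos_affine_le[OF r w, where a = a] by (simp add: comm)
    qed measurable
    show "AE s in angle. integrable angle (\<lambda>t. ?f (s, t))"
      using integrable_ln_abs_cos_affine[OF r w, where a = a] by (simp add: comm)
  qed measurable
  have "(\<integral>z. ?f z \<partial>(angle \<Otimes>\<^sub>M angle)) = (\<integral>s. (\<integral>t. ?f (s, t) \<partial>angle) \<partial>angle)"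
    using angle_pair.integral_fst'[OF int] by simp
  also have "\<dots> = (\<integral>s. ln r + (\<integral>t. ln \<bar>cos t\<bar> \<partial>angle) \<partial>angle)"
    using integral_ln_abs_cos_affine[OF r w, where a = a] by (simp add: comm)
  finally show "(\<integral>z. ?f z \<partial>(angle \<Otimes>\<^sub>M angle)) = ln r + (\<integral>t. ln \<bar>cos t\<bar> \<partial>angle)"
    by (simp add: angle.prob_space[simplified])
qed

text \<open>If \<open>q\<close> is the larger amplitude, exchanging the two angles, which preserves
  the product measure, reduces to the ordered case.\<close>

lemma
  fixes a c :: real
  assumes q: "0 \<le> q" and r: "0 \<le> r" and pos: "0 < max q r"
  shows AE_torus_neq_0: "AE z in angle \<Otimes>\<^sub>M angle. q * cos (fst z + c) + r * cos (snd z + a) \<noteq> 0"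
    and integrable_torus:
      "integrable (angle \<Otimes>\<^sub>M angle) (\<lambda>z. ln \<bar>q * cos (fst z + c) + r * cos (snd z + a)\<bar>)"
    and integral_torus:
      "(\<integral>z. ln \<bar>q * cos (fst z + c) + r * cos (snd z + a)\<bar> \<partial>(angle \<Otimes>\<^sub>M angle)) =
        ln (max q r) + (\<integral>t. ln \<bar>cos t\<bar> \<partial>angle)"
proof -
  let ?P = "angle \<Otimes>\<^sub>M angle"
  define f where "f = (\<lambda>q c r a (z :: real \<times> real). q * cos (fst z + c) + r * cos (snd z + a))"
  have [measurable]: "f q c r a \<in> borel_measurable ?P" for q c r a
    unfolding f_def by measurable
  have swap: "f q c r a (prod.swap z) = f r a q c z" for q c r a z
    by (simp add: f_def add.commute)
  have "(AE z in ?P. f q c r a z \<noteq> 0) \<and> integrable ?P (\<lambda>z. ln \<bar>f q c r a z\<bar>) \<and>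
      (\<integral>z. ln \<bar>f q c r a z\<bar> \<partial>?P) = ln (max q r) + (\<integral>t. ln \<bar>cos t\<bar> \<partial>angle)"
  proof (cases "q \<le> r")
    case True
    then have "0 < r" using pos by simp
    with True show ?thesis
      using AE_torus_neq_0_aux[OF q True] integrable_torus_aux[OF q True] integral_torus_aux[OF q True]
      by (simp add: f_def max_def)
  next
    case False
    then have rq: "r \<le> q" "0 < q" using r by auto
    have P: "?P = distr ?P ?P prod.swap"
      using angle_pair.distr_pair_swap by (simp add: case_prod_beta' prod.swap_def [abs_def])
    have m [measurable]: "prod.swap \<in> measurable ?P ?P"
      unfolding prod.swap_def [abs_def] by measurable
    have aux: "AE z in ?P. f r a q c z \<noteq> 0" "integrable ?P (\<lambda>z. ln \<bar>f r a q c z\<bar>)"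
      "(\<integral>z. ln \<bar>f r a q c z\<bar> \<partial>?P) = ln q + (\<integral>t. ln \<bar>cos t\<bar> \<partial>angle)"
      unfolding f_def by (fact AE_torus_neq_0_aux[OF r rq] integrable_torus_aux[OF r rq] integral_torus_aux[OF r rq])+
    have "{z \<in> space ?P. f q c r a z \<noteq> 0} \<in> sets ?P"
      by measurable
    then have "AE z in distr ?P ?P prod.swap. f q c r a z \<noteq> 0"
      using aux(1) by (simp add: AE_distr_iff[OF m] swap)
    moreover have "integrable (distr ?P ?P prod.swap) (\<lambda>z. ln \<bar>f q c r a z\<bar>)"
      using aux(2) by (subst integrable_distr_eq[OF m]) (simp_all add: swap)
    moreover have "(\<integral>z. ln \<bar>f q c r a z\<bar> \<partial>distr ?P ?P prod.swap) = ln q + (\<integral>t. ln \<bar>cos t\<bar> \<partial>angle)"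
      using aux(3) by (subst integral_distr[OF m]) (simp_all add: swap)
    ultimately show ?thesis
      using rq unfolding P[symmetric] by (simp add: max_def)
  qed
  then show "AE z in ?P. q * cos (fst z + c) + r * cos (snd z + a) \<noteq> 0"
    "integrable ?P (\<lambda>z. ln \<bar>q * cos (fst z + c) + r * cos (snd z + a)\<bar>)"
    "(\<integral>z. ln \<bar>q * cos (fst z + c) + r * cos (snd z + a)\<bar> \<partial>?P) =
        ln (max q r) + (\<integral>t. ln \<bar>cos t\<bar> \<partial>angle)"
    by (simp_all add: f_def)
qed

section \<open>The norm on four-dimensional space\<close>

text \<open>Reading the coordinate planes as complex numbers gives the triangle inequality through
  \<open>cmod\<close> and polar coordinates through \<open>Arg\<close>.\<close>

definition max_norm :: "(nat \<Rightarrow> real) \<Rightarrow> real" where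
  "max_norm x = max (cmod (Complex (x 0) (x 1))) (cmod (Complex (x 2) (x 3)))"

lemma dotp_4: "dotp 4 x y = x 0 * y 0 + x 1 * y 1 + x 2 * y 2 + x 3 * y 3"
  by (simp add: dotp_def numeral_eq_Suc)

lemma Rn_4_eq_0_iff:
  assumes "x \<in> Rn 4"
  shows "x = (\<lambda>i. 0) \<longleftrightarrow> x 0 = 0 \<and> x 1 = 0 \<and> x 2 = 0 \<and> x 3 = 0"
proof
  assume *: "x 0 = 0 \<and> x 1 = 0 \<and> x 2 = 0 \<and> x 3 = 0"
  show "x = (\<lambda>i. 0)"
  proof
    fix i :: nat
    have "i = 0 \<or> i = 1 \<or> i = 2 \<or> i = 3 \<or> 4 \<le> i"
      by linarith
    with * assms show "x i = 0"
      by (auto simp: topspace_Euclidean_space)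
  qed
qed auto

lemma max_norm_eq_0_iff: "x \<in> Rn 4 \<Longrightarrow> max_norm x = 0 \<longleftrightarrow> x = (\<lambda>i. 0)"
proof -
  assume x: "x \<in> Rn 4"
  have "max_norm x = 0 \<longleftrightarrow> cmod (Complex (x 0) (x 1)) = 0 \<and> cmod (Complex (x 2) (x 3)) = 0"
    using norm_ge_zero[of "Complex (x 0) (x 1)"] norm_ge_zero[of "Complex (x 2) (x 3)"]
    unfolding max_norm_def by linarith
  then show ?thesis
    by (simp only: Rn_4_eq_0_iff[OF x] norm_eq_zero) (simp add: complex_eq_iff)
qed

lemma normed_space_max_norm: "normed_space 4 max_norm"
  unfolding normed_space_def
proof (intro conjI ballI allI)
  fix x y :: "nat \<Rightarrow> real" and c :: real
  show "0 \<le> max_norm x"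
    by (simp add: max_norm_def le_max_iff_disj)
  have "Complex (c * x i) (c * x j) = of_real c * Complex (x i) (x j)" for i j
    by (simp add: complex_eq_iff)
  then show "max_norm (\<lambda>i. c * x i) = \<bar>c\<bar> * max_norm x"
    by (simp add: max_norm_def norm_mult max_mult_distrib_left)
  have "cmod (Complex (x i + y i) (x j + y j)) \<le> cmod (Complex (x i) (x j)) + cmod (Complex (y i) (y j))" for i j
    using norm_triangle_ineq[of "Complex (x i) (x j)" "Complex (y i) (y j)"] by (simp add: complex_add)
  from this[of 0 1] this[of 2 3] show "max_norm (\<lambda>i. x i + y i) \<le> max_norm x + max_norm y"
    unfolding max_norm_def by linarith
qed (simp add: max_norm_eq_0_iff)

section \<open>Embedding in L_0 by the Clifford torus\<close>

text \<open>The factor \<open>1 / sqrt 2\<close> puts the torus on the unit sphere and only adds a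
  constant after taking logarithms.\<close>

definition clifford_torus :: "real \<times> real \<Rightarrow> nat \<Rightarrow> real" where
  "clifford_torus = (\<lambda>(s, t) i.
     if i = 0 then cos s / sqrt 2 else if i = 1 then sin s / sqrt 2
     else if i = 2 then cos t / sqrt 2 else if i = 3 then sin t / sqrt 2 else 0)"

lemma clifford_torus_in_sphere: "clifford_torus z \<in> unit_sphere 4"
  by (cases z)
     (simp add: unit_sphere_def clifford_torus_def dotp_4 topspace_Euclidean_space
        power2_eq_square[symmetric] power_divide flip: add_divide_distrib add.assoc)

lemma measurable_clifford_torus:
  "clifford_torus \<in> measurable (angle \<Otimes>\<^sub>M angle) (restrict_space borel (unit_sphere 4))"
proof (rule measurable_restrict_space2)
  show "clifford_torus \<in> borel_measurable (angle \<Otimes>\<^sub>M angle)"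
  proof (rule measurable_coordinatewise_then_product)
    show "(\<lambda>z. clifford_torus z i) \<in> borel_measurable (angle \<Otimes>\<^sub>M angle)" for i
      unfolding clifford_torus_def case_prod_beta
      by (cases "i = 0"; cases "i = 1"; cases "i = 2"; cases "i = 3"; simp)
  qed
qed (use clifford_torus_in_sphere in auto)

lemma borel_measurable_dotp:
  assumes "sets M = sets (restrict_space borel S)"
  shows "(\<lambda>\<xi>. dotp n x \<xi>) \<in> borel_measurable M"
proof -
  have "(\<lambda>\<xi>. dotp n x \<xi>) \<in> borel_measurable (borel :: (nat \<Rightarrow> real) measure)"
    unfolding dotp_def by (intro borel_measurable_continuous_onI continuous_intros continuous_on_product_coordinates)
  then show ?thesis
    by (subst measurable_cong_sets[OF assms refl]) (rule measurable_restrict_space1)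
qed

lemma embeds_L0_max_norm: "embeds_L0 4 max_norm"
proof -
  let ?P = "angle \<Otimes>\<^sub>M angle"
  define \<mu> where "\<mu> = distr ?P (restrict_space borel (unit_sphere 4)) clifford_torus"
  note [measurable] = measurable_clifford_torus
  have sets: "sets \<mu> = sets (restrict_space borel (unit_sphere 4))"
    by (simp add: \<mu>_def)
  have "finite_measure \<mu>"
    unfolding \<mu>_def by (intro angle_pair.P.finite_measure_distr) measurable
  with sets have "sphere_measure 4 \<mu>"
    by (simp add: sphere_measure_def)
  \<comment> \<open>The additive constant undoes the scaling by \<open>1 / sqrt 2\<close> and the
    average of \<open>ln |cos t|\<close> left over from the torus integral.\<close>
  moreover have "(AE \<xi> in \<mu>. dotp 4 x \<xi> \<noteq> 0) \<and> integrable \<mu> (\<lambda>\<xi>. ln \<bar>dotp 4 x \<xi>\<bar>) \<and>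
      ln (max_norm x) = (\<integral>\<xi>. ln \<bar>dotp 4 x \<xi>\<bar> \<partial>\<mu>) + (ln (sqrt 2) - (\<integral>t. ln \<bar>cos t\<bar> \<partial>angle))"
    if x: "x \<in> Rn 4" "x \<noteq> (\<lambda>i. 0)" for x
  proof -
    \<comment> \<open>The phases are negated arguments so that
      \<open>x 0 * cos s + x 1 * sin s = q * cos (s + c)\<close>, and likewise in the second
      plane.\<close>
    define q c r a where "q = cmod (Complex (x 0) (x 1))" and "c = - Arg (Complex (x 0) (x 1))"
      and "r = cmod (Complex (x 2) (x 3))" and "a = - Arg (Complex (x 2) (x 3))"
    have N: "max_norm x = max q r"
      by (simp add: max_norm_def q_def r_def)
    have qr: "0 \<le> q" "0 \<le> r" "0 < max q r"
      using max_norm_eq_0_iff[OF x(1)] x(2) unfolding N by (auto simp: q_def r_def less_max_iff_disj)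
    have "rcis q (- c) = Complex (x 0) (x 1)" "rcis r (- a) = Complex (x 2) (x 3)"
      by (simp_all add: q_def c_def r_def a_def rcis_cmod_Arg)
    then have coords: "x 0 = q * cos c" "x 1 = - q * sin c" "x 2 = r * cos a" "x 3 = - r * sin a"
      by (simp_all add: complex_eq_iff)
    define g where "g = (\<lambda>z. q * cos (fst z + c) + r * cos (snd z + a))"
    have dotp: "dotp 4 x (clifford_torus z) = g z / sqrt 2" for z
      by (cases z) (simp add: dotp_4 clifford_torus_def g_def coords[unfolded One_nat_def] cos_add field_simps)
    have [measurable]: "(\<lambda>\<xi>. dotp 4 x \<xi>) \<in> borel_measurable (restrict_space borel (unit_sphere 4))"
      "g \<in> borel_measurable ?P"
      by (rule borel_measurable_dotp) (simp_all add: g_def)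
    have ne: "AE z in ?P. g z \<noteq> 0" and int: "integrable ?P (\<lambda>z. ln \<bar>g z\<bar>)"
      and val: "(\<integral>z. ln \<bar>g z\<bar> \<partial>?P) = ln (max_norm x) + (\<integral>t. ln \<bar>cos t\<bar> \<partial>angle)"
      using AE_torus_neq_0[OF qr] integrable_torus[OF qr] integral_torus[OF qr]
      unfolding g_def N by blast+
    have eq: "AE z in ?P. ln \<bar>dotp 4 x (clifford_torus z)\<bar> = ln \<bar>g z\<bar> - ln (sqrt 2)"
      using ne by eventually_elim (simp add: dotp ln_div)
    have "AE \<xi> in \<mu>. dotp 4 x \<xi> \<noteq> 0"
      unfolding \<mu>_def using ne by (subst AE_distr_iff) (auto simp: dotp)
    moreover have "integrable ?P (\<lambda>z. ln \<bar>dotp 4 x (clifford_torus z)\<bar>)"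
      using int by (subst integrable_cong_AE[OF _ _ eq]) auto
    then have "integrable \<mu> (\<lambda>\<xi>. ln \<bar>dotp 4 x \<xi>\<bar>)"
      unfolding \<mu>_def by (subst integrable_distr_eq) auto
    moreover have "(\<integral>\<xi>. ln \<bar>dotp 4 x \<xi>\<bar> \<partial>\<mu>) = (\<integral>z. ln \<bar>dotp 4 x (clifford_torus z)\<bar> \<partial>?P)"
      unfolding \<mu>_def by (rule integral_distr) auto
    moreover have "\<dots> = (\<integral>z. ln \<bar>g z\<bar> - ln (sqrt 2) \<partial>?P)"
      by (rule integral_cong_AE[OF _ _ eq]) auto
    moreover have "\<dots> = (\<integral>z. ln \<bar>g z\<bar> \<partial>?P) - ln (sqrt 2)"
      using int by (simp add: angle_pair.P.prob_space[simplified])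
    ultimately show ?thesis
      by (simp add: val)
  qed
  ultimately show ?thesis
    unfolding embeds_L0_def by blast
qed

section \<open>No embedding in L_p for positive \<open>p\<close>\<close>

lemma abs_dotp_le:
  assumes "\<xi> \<in> unit_sphere n"
  shows "\<bar>dotp n x \<xi>\<bar> \<le> (\<Sum>i<n. \<bar>x i\<bar>)"
proof -
  have "\<bar>x i * \<xi> i\<bar> \<le> \<bar>x i\<bar>" if "i < n" for i
  proof -
    have "\<xi> i * \<xi> i \<le> (\<Sum>i<n. \<xi> i * \<xi> i)"
      using that by (intro member_le_sum) auto
    then have "\<bar>\<xi> i\<bar> \<le> 1"
      using assms by (simp add: unit_sphere_def dotp_def abs_square_le_1 flip: power2_eq_square)
    then show ?thesis
      by (simp add: abs_mult mult_left_le)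
  qed
  then show ?thesis
    unfolding dotp_def by (intro order_trans[OF sum_abs] sum_mono) auto
qed

lemma not_embeds_Lp_max_norm:
  assumes p: "0 < p"
  shows "\<not> embeds_Lp p 4 max_norm"
proof
  assume "embeds_Lp p 4 max_norm"
  then obtain \<mu> where \<mu>: "sphere_measure 4 \<mu>"
    and rep: "\<And>x. x \<in> Rn 4 \<Longrightarrow> max_norm x powr p = (\<integral>\<xi>. \<bar>dotp 4 x \<xi>\<bar> powr p \<partial>\<mu>)"
    unfolding embeds_Lp_def by blast
  interpret \<mu>: finite_measure \<mu>
    using \<mu> by (simp add: sphere_measure_def)
  have sets: "sets \<mu> = sets (restrict_space borel (unit_sphere 4))"
    using \<mu> by (simp add: sphere_measure_def)
  have space: "space \<mu> = unit_sphere 4"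
    using sets_eq_imp_space_eq[OF sets] by (simp add: space_restrict_space)
  interpret Q: pair_sigma_finite \<mu> angle ..
  interpret Qf: finite_measure "\<mu> \<Otimes>\<^sub>M angle"
    by (rule finite_measure_pair_measure) (unfold_locales)
  \<comment> \<open>A unit circle in the first plane, displaced by \<open>z\<close> in the second:
    the maximum does not see the displacement as long as \<open>|z| <= 1\<close>.\<close>
  define v where "v = (\<lambda>(z::real) t (i::nat). if i = 0 then cos t else if i = 1 then sin t else if i = 2 then z else (0::real) :: real)"
  have v: "v z t \<in> Rn 4" for z t
    by (simp add: v_def topspace_Euclidean_space)
  have dotp_v: "dotp 4 (v z t) \<xi> = cos t * \<xi> 0 + sin t * \<xi> 1 + z * \<xi> 2" for z t \<xi>
    by (simp add: v_def dotp_4)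
  have norm_v: "max_norm (v z t) = 1" if "\<bar>z\<bar> \<le> 1" for z t
    using that by (simp add: v_def max_norm_def cmod_def)
  have coord [measurable]: "(\<lambda>\<xi>. \<xi> i) \<in> borel_measurable \<mu>" for i
    by (subst measurable_cong_sets[OF sets refl])
       (intro measurable_restrict_space1 borel_measurable_continuous_onI continuous_on_product_coordinates)
  \<comment> \<open>Averaging over the circle for fixed \<open>\<xi>\<close> puts the integrand in
    the form \<open>A * cos (t + a) + B\<close> with \<open>B = z * \<xi> 2\<close>, where the
    strict comparison applies.\<close>
  define G where "G = (\<lambda>z \<xi>. \<integral>t. \<bar>dotp 4 (v z t) \<xi>\<bar> powr p \<partial>angle)"
  have int: "integrable (\<mu> \<Otimes>\<^sub>M angle) (\<lambda>(\<xi>, t). \<bar>dotp 4 (v z t) \<xi>\<bar> powr p)" if z: "\<bar>z\<bar> \<le> 1" for z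
  proof (rule Qf.integrable_const_bound[where B = "3 powr p"])
    have "\<bar>dotp 4 (v z t) \<xi>\<bar> \<le> 3" if "\<xi> \<in> unit_sphere 4" for \<xi> t
    proof -
      have "\<bar>dotp 4 (v z t) \<xi>\<bar> \<le> \<bar>cos t\<bar> + \<bar>sin t\<bar> + \<bar>z\<bar>"
        using abs_dotp_le[OF that, of "v z t"] by (simp add: v_def numeral_eq_Suc)
      also have "\<dots> \<le> 3"
        using z abs_cos_le_one[of t] abs_sin_le_one[of t] by linarith
      finally show ?thesis .
    qed
    then show "AE w in \<mu> \<Otimes>\<^sub>M angle. norm (case w of (\<xi>, t) \<Rightarrow> \<bar>dotp 4 (v z t) \<xi>\<bar> powr p) \<le> 3 powr p"
      using p by (intro AE_I2) (auto simp: space_pair_measure space intro!: powr_mono2)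
  qed (simp add: dotp_v)
  \<comment> \<open>With the order of integration exchanged, the inner integral is
    \<open>max_norm (v z t) powr p = 1\<close>, for each such \<open>z\<close>.\<close>
  have total: "integrable \<mu> (G z)" "(\<integral>\<xi>. G z \<xi> \<partial>\<mu>) = 1" if z: "\<bar>z\<bar> \<le> 1" for z
  proof -
    show "integrable \<mu> (G z)"
      using Q.integrable_fst'[OF int[OF z]] by (simp add: G_def)
    have "(\<integral>\<xi>. G z \<xi> \<partial>\<mu>) = (\<integral>t. (\<integral>\<xi>. \<bar>dotp 4 (v z t) \<xi>\<bar> powr p \<partial>\<mu>) \<partial>angle)"
      unfolding G_def using Q.Fubini_integral[OF int[OF z]] by simp
    also have "\<dots> = (\<integral>t. 1 \<partial>angle)"
      using norm_v[OF z] by (simp flip: rep[OF v])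
    finally show "(\<integral>\<xi>. G z \<xi> \<partial>\<mu>) = 1"
      by (simp add: angle.prob_space[simplified])
  qed
  have G_less: "G 0 \<xi> < G 1 \<xi>" if "\<xi> 2 \<noteq> 0" for \<xi>
  proof -
    obtain A a where Aa: "\<xi> 0 = A * cos a" "\<xi> 1 = A * sin a"
      using polar_Ex by blast
    have "dotp 4 (v z t) \<xi> = A * cos (t + - a) + z * \<xi> 2" for z t
      by (simp add: dotp_v Aa[unfolded One_nat_def] cos_diff algebra_simps)
    then show ?thesis
      using integral_abs_cos_affine_powr_gt[OF p that, of A "- a"] by (simp add: G_def)
  qed
  have G_le: "G 0 \<xi> \<le> G 1 \<xi>" for \<xi>
    using G_less[of \<xi>] by (cases "\<xi> 2 = 0") (auto simp: G_def dotp_v)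
  \<comment> \<open>A nonnegative function with integral \<open>1 - 1\<close> vanishes almost
    everywhere; by \<open>G_less\<close> it can do so only where \<open>\<xi> 2 = 0\<close>.\<close>
  have "(\<integral>\<xi>. G 1 \<xi> - G 0 \<xi> \<partial>\<mu>) = 0"
    using total[of 0] total[of 1] by simp
  then have "AE \<xi> in \<mu>. G 1 \<xi> - G 0 \<xi> = 0"
    using total[of 0] total[of 1] G_le by (subst (asm) integral_nonneg_eq_0_iff_AE) auto
  then have "AE \<xi> in \<mu>. \<xi> 2 = 0"
    by eventually_elim (use G_less in force)
  \<comment> \<open>The unit vector normal to the hyperplane carrying \<open>\<mu>\<close>: its norm
    is \<open>1\<close>, but the representation would give \<open>0\<close>.\<close>
  define e where "e = (\<lambda>i::nat. if i = 2 then 1 else 0 :: real)"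
  have "(\<integral>\<xi>. \<bar>dotp 4 e \<xi>\<bar> powr p \<partial>\<mu>) = (\<integral>\<xi>. 0 \<partial>\<mu>)"
    using \<open>AE \<xi> in \<mu>. \<xi> 2 = 0\<close>
    by (intro integral_cong_AE) (auto simp: dotp_4 e_def elim!: eventually_mono)
  moreover have "max_norm e = 1" "e \<in> Rn 4"
    by (simp_all add: e_def max_norm_def cmod_def topspace_Euclidean_space)
  ultimately show False
    using rep[of e] by simp
qed

theorem theorem6p5:
  shows "\<exists>(n::nat) (N :: (nat \<Rightarrow> real) \<Rightarrow> real).
           normed_space n N \<and> embeds_L0 n N \<and> (\<forall>p::real. 0 < p \<longrightarrow> \<not> embeds_Lp p n N)"
  using normed_space_max_norm embeds_L0_max_norm not_embeds_Lp_max_norm by blast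

end
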